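(* Let $P$ be a Markov transition kernel on $\mathsf{X}$. Assume that there exist a non-decreasing function $r : \mathbb{N} \to (0, \infty)$ with $\lim_{k\to\infty} r(k) = \infty$, measurable functions $W,V : \mathsf{X} \to [1, \infty)$ and a constant $C< \infty$ such that $$\forall (x,x') \in \mathsf{X} \times \mathsf{X}, \ \forall k \in \mathbb{N}: \qquad r(k)\, \| P^k(x, \cdot) - P^k(x', \cdot) \|_W \leq C \left( V(x) + V(x') \right),$$ $$\exists x_0 \in \mathsf{X}: \qquad \sup_{k \geq 0} P^k W(x_0) < \infty .$$ Let $\beta \in (0,1)$ and let $n : \mathsf{X} \to \mathbb{N}$ satisfy $n(x) \geq r^{-1} \left(\frac{C}{\beta} \, \frac{V(x)}{W(x)} \right)$ for all $x \in \mathsf{X}$, where $r^{-1}(t) := \inf \{k \in \mathbb{N} : r(k) \geq t\}$ denotes the generalized inverse of $r$. Then there exists $b< \infty$ such that $P^{n(x)} W (x) \leq \beta W(x) + b$ for all $x \in \mathsf{X}$. In addition, for any $\beta'$ with $\beta < \beta' < 1$, setting $\mathcal{C} := \{x \in \mathsf{X} : W(x) \leq b(\beta'-\beta)^{-1}\}$, one has $$P^{n(x)} W(x) \leq \beta' W(x) + b\,\mathbf{1}_{\mathcal{C}}(x) \qquad \text{for all } x \in \mathsf{X}.$$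
   Context: $\mathsf{X}$ is a general (measurable) state space, $P$ the transition kernel of a time-homogeneous Markov chain on $\mathsf{X}$, and $P^k(x,dy)$ the $k$-step transition kernel. For a non-negative function $f$, $P^kf(x) = \int P^k(x,dy) f(y)$. For a signed measure $\mu$, $\mu(g) = \int g\,d\mu$ and $\|\mu\|_f := \sup_{\{g : |g|\leq f\}} |\mu(g)|$. $\mathbf{1}_{\mathcal{C}}$ is the indicator function of $\mathcal{C}$. $\mathbb{N}=\{0,1,2,\dots\}$. *)

theory Defs
  imports "HOL-Probability.Probability"
begin

text \<open>A Markov transition kernel on the measurable space \<open>M\<close> is a function
  \<open>P \<in> M \<rightarrow>\<^sub>M prob_algebra M\<close>; the state space is \<open>space M\<close>.\<close>

primrec kernel_power :: "'a measure \<Rightarrow> ('a \<Rightarrow> 'a measure) \<Rightarrow> nat \<Rightarrow> 'a \<Rightarrow> 'a measure" where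
  "kernel_power M P 0 = return M"
| "kernel_power M P (Suc k) = (\<lambda>x. P x \<bind> kernel_power M P k)"

definition kernel_app :: "('a \<Rightarrow> 'a measure) \<Rightarrow> ('a \<Rightarrow> real) \<Rightarrow> 'a \<Rightarrow> ennreal" where
  "kernel_app K f x = (\<integral>\<^sup>+y. ennreal (f y) \<partial>K x)"

text \<open>The weighted norm \<open>\<parallel>\<mu> - \<nu>\<parallel>\<^sub>f\<close> of the signed measure \<open>\<mu> - \<nu>\<close>, where \<open>\<mu>\<close> and \<open>\<nu>\<close>
  are finite measures on the same measurable space; the value may be infinite.
  A test function has to be integrable (in particular measurable) with respect to both measures, so
  that its integral against \<open>\<mu> - \<nu>\<close> is the difference of the two integrals. This does not
  change the supremum: the bounded test functions alone already give, by truncation, the integral of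
  \<open>f\<close> against the total variation of \<open>\<mu> - \<nu>\<close>, also when \<open>f\<close> is not integrable.\<close>

definition weighted_norm_diff :: "('a \<Rightarrow> real) \<Rightarrow> 'a measure \<Rightarrow> 'a measure \<Rightarrow> ereal" where
  "weighted_norm_diff f \<mu> \<nu> =
     (SUP g \<in> {g. integrable \<mu> g \<and> integrable \<nu> g \<and> (\<forall>x\<in>space \<mu>. \<bar>g x\<bar> \<le> f x)}.
        ereal \<bar>(\<integral>x. g x \<partial>\<mu>) - (\<integral>x. g x \<partial>\<nu>)\<bar>)"

text \<open>The set below is nonempty for every \<open>t\<close> when \<open>r\<close> is unbounded above; otherwise the infimum
  in \<^typ>\<open>nat\<close> would be \<open>0\<close> rather than infinite.\<close>

definition gen_inverse :: "(nat \<Rightarrow> real) \<Rightarrow> real \<Rightarrow> nat" where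
  "gen_inverse r t = Inf {k. t \<le> r k}"

end

theory Submission
  imports Defs
begin

text \<open>Comparing the orbit of \<open>x\<close> with that of \<open>x\<^sub>0\<close> after \<open>k\<close> steps costs at most
  \<open>C (V x + V x\<^sub>0) / r k\<close>, the difference of the integrals of \<open>W\<close> being controlled through the
  truncations \<open>min W m\<close>. For \<open>k = n x\<close> the choice of \<open>n\<close> turns \<open>C V x / r k\<close> into at most
  \<open>\<beta> W x\<close>, while \<open>C V x\<^sub>0 / r k \<le> C V x\<^sub>0 / r 0\<close>; hence
  \<open>b = sup\<^sub>k P\<^sup>k W x\<^sub>0 + C V x\<^sub>0 / r 0\<close> works.\<close>

lemma kernel_power_measurable:
  assumes P: "P \<in> M \<rightarrow>\<^sub>M prob_algebra M"
  shows "kernel_power M P k \<in> M \<rightarrow>\<^sub>M prob_algebra M"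
proof (induction k)
  case 0
  show ?case by (simp add: measurable_return_prob_space)
next
  case (Suc k)
  then show ?case
    using measurable_bind_prob_space[OF P Suc] by simp
qed

text \<open>Divergence of \<open>r\<close> makes the set under the infimum nonempty, so the infimum
  is attained; monotonicity carries the bound from there on to \<open>k\<close>.\<close>

lemma gen_inverse_le:
  assumes "mono r" and "filterlim r at_top sequentially" and "gen_inverse r t \<le> k"
  shows "t \<le> r k"
proof -
  obtain j where "t \<le> r j"
    using assms(2) by (metis eventually_sequentially filterlim_at_top order_refl)
  then have "gen_inverse r t \<in> {k. t \<le> r k}"
    unfolding gen_inverse_def by (intro Inf_nat_def1) auto
  then show ?thesis
    using monoD[OF assms(1,3)] by simp
qed

text \<open>The zero function is an admissible test function. If \<open>f\<close> were negative
  somewhere on the space, there would be none, and the supremum would be minus infinity.\<close>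

lemma weighted_norm_diff_nonneg:
  assumes "\<And>x. x \<in> space \<mu> \<Longrightarrow> 0 \<le> f x"
  shows "0 \<le> weighted_norm_diff f \<mu> \<nu>"
  unfolding weighted_norm_diff_def by (rule SUP_upper2[of "\<lambda>_. 0"]) (use assms in auto)

text \<open>As \<open>f\<close> may fail to be integrable, it need not be a test function itself.
  Its truncations are bounded, hence integrable for finite measures, and the bound \<open>c\<close>
  does not depend on the truncation level, so it survives monotone convergence.\<close>

lemma nn_integral_le_weighted_norm_diff:
  assumes "finite_measure \<mu>" and "finite_measure \<nu>"
    and sets: "sets \<nu> = sets \<mu>"
    and f: "f \<in> borel_measurable \<mu>" and f_nonneg: "\<And>x. x \<in> space \<mu> \<Longrightarrow> 0 \<le> f x"
    and le: "weighted_norm_diff f \<mu> \<nu> \<le> ereal c"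
  shows "(\<integral>\<^sup>+x. ennreal (f x) \<partial>\<mu>) \<le> (\<integral>\<^sup>+x. ennreal (f x) \<partial>\<nu>) + ennreal c"
proof -
  interpret \<mu>: finite_measure \<mu> by fact
  interpret \<nu>: finite_measure \<nu> by fact
  have space: "space \<nu> = space \<mu>" using sets by (rule sets_eq_imp_space_eq)
  have f': "f \<in> borel_measurable \<nu>" using f sets by (simp cong: measurable_cong_sets)
  have c: "0 \<le> c"
    using weighted_norm_diff_nonneg[of \<mu> f \<nu>] f_nonneg le by (metis ereal_less_eq(5) order_trans)
  define g where "g m x = min (f x) (real m)" for m x
  have g_le: "g m x \<le> f x" for m x by (simp add: g_def)
  have trunc: "(\<integral>\<^sup>+x. ennreal (g m x) \<partial>\<mu>) \<le> (\<integral>\<^sup>+x. ennreal (f x) \<partial>\<nu>) + ennreal c" for m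
  proof -
    have nonneg: "0 \<le> g m x" if "x \<in> space \<mu>" for x
      using f_nonneg[OF that] by (simp add: g_def)
    have int: "integrable \<mu> (g m)" "integrable \<nu> (g m)"
      using f f' f_nonneg space
      by (auto intro!: \<mu>.integrable_const_bound[where B = m] \<nu>.integrable_const_bound[where B = m]
            AE_I2 simp: g_def[abs_def])
    have "ereal \<bar>integral\<^sup>L \<mu> (g m) - integral\<^sup>L \<nu> (g m)\<bar> \<le> weighted_norm_diff f \<mu> \<nu>"
      unfolding weighted_norm_diff_def
      by (rule SUP_upper) (use int nonneg in \<open>simp add: g_le\<close>)
    then have "integral\<^sup>L \<mu> (g m) \<le> integral\<^sup>L \<nu> (g m) + c"
      using order_trans[OF _ le] by fastforce
    \<comment> \<open>Together with \<open>0 \<le> c\<close> this lets \<open>ennreal\<close> split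
      over the sum.\<close>
    moreover have "0 \<le> integral\<^sup>L \<nu> (g m)"
      using nonneg space by (intro Bochner_Integration.integral_nonneg) simp
    moreover have "(\<integral>\<^sup>+x. ennreal (g m x) \<partial>\<mu>) = ennreal (integral\<^sup>L \<mu> (g m))"
      using int(1) nonneg by (intro nn_integral_eq_integral) auto
    moreover have "(\<integral>\<^sup>+x. ennreal (g m x) \<partial>\<nu>) = ennreal (integral\<^sup>L \<nu> (g m))"
      using int(2) nonneg space by (intro nn_integral_eq_integral) auto
    ultimately have "(\<integral>\<^sup>+x. ennreal (g m x) \<partial>\<mu>) \<le> (\<integral>\<^sup>+x. ennreal (g m x) \<partial>\<nu>) + ennreal c"
      using c by (simp flip: ennreal_plus add: ennreal_leI)
    also have "\<dots> \<le> (\<integral>\<^sup>+x. ennreal (f x) \<partial>\<nu>) + ennreal c"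
      by (intro add_right_mono nn_integral_mono ennreal_leI g_le)
    finally show ?thesis .
  qed
  have "ennreal (f x) = (SUP m. ennreal (g m x))" for x
  proof (rule antisym)
    obtain m where "f x \<le> real m" using real_arch_simple by blast
    then show "ennreal (f x) \<le> (SUP m. ennreal (g m x))"
      by (intro SUP_upper2[of m]) (auto simp: g_def)
  qed (auto simp: g_def intro!: SUP_least ennreal_leI)
  then have "(\<integral>\<^sup>+x. ennreal (f x) \<partial>\<mu>) = (SUP m. \<integral>\<^sup>+x. ennreal (g m x) \<partial>\<mu>)"
    using f by (subst nn_integral_monotone_convergence_SUP[symmetric])
      (auto simp: g_def[abs_def] incseq_def le_fun_def min_le_iff_disj intro!: ennreal_leI)
  also have "\<dots> \<le> (\<integral>\<^sup>+x. ennreal (f x) \<partial>\<nu>) + ennreal c"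
    using trunc by (rule SUP_least)
  finally show ?thesis .
qed

theorem theorem2p1:
  fixes M :: "'a measure" and P :: "'a \<Rightarrow> 'a measure"
    and r :: "nat \<Rightarrow> real" and W V :: "'a \<Rightarrow> real" and C \<beta> :: real and n :: "'a \<Rightarrow> nat"
  assumes P: "P \<in> M \<rightarrow>\<^sub>M prob_algebra M"
    and r_mono: "mono r" and r_pos: "\<And>k. 0 < r k"
    and r_lim: "filterlim r at_top sequentially"
    and W: "W \<in> borel_measurable M" and W_ge: "\<And>x. x \<in> space M \<Longrightarrow> 1 \<le> W x"
    and V: "V \<in> borel_measurable M" and V_ge: "\<And>x. x \<in> space M \<Longrightarrow> 1 \<le> V x"
    and rate: "\<And>x x' k. x \<in> space M \<Longrightarrow> x' \<in> space M \<Longrightarrow>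
        ereal (r k) * weighted_norm_diff W (kernel_power M P k x) (kernel_power M P k x')
          \<le> ereal (C * (V x + V x'))"
    and bounded_orbit: "\<exists>x\<^sub>0\<in>space M. (SUP k. kernel_app (kernel_power M P k) W x\<^sub>0) < \<infinity>"
    and \<beta>: "0 < \<beta>" "\<beta> < 1"
    and n: "\<And>x. x \<in> space M \<Longrightarrow> gen_inverse r (C / \<beta> * (V x / W x)) \<le> n x"
  shows "\<exists>b::real.
      (\<forall>x\<in>space M. kernel_app (kernel_power M P (n x)) W x \<le> ennreal (\<beta> * W x + b)) \<and>
      (\<forall>\<beta>'. \<beta> < \<beta>' \<and> \<beta>' < 1 \<longrightarrow>
        (\<forall>x\<in>space M. kernel_app (kernel_power M P (n x)) W x
           \<le> ennreal (\<beta>' * W x + b * indicator {y \<in> space M. W y \<le> b / (\<beta>' - \<beta>)} x)))"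
proof -
  let ?K = "kernel_power M P"
  obtain x0 where x0: "x0 \<in> space M"
    and "(SUP k. kernel_app (?K k) W x0) < \<infinity>"
    using bounded_orbit by blast
  \<comment> \<open>The bound at \<open>x0\<close> has to be uniform in \<open>k\<close>, because it
    is applied at \<open>k = n x\<close> for every \<open>x\<close>.\<close>
  then obtain B where B: "0 \<le> B" and "(SUP k. kernel_app (?K k) W x0) = ennreal B"
    by (cases "SUP k. kernel_app (?K k) W x0") auto
  then have orbit: "kernel_app (?K k) W x0 \<le> ennreal B" for k
    by (metis SUP_upper UNIV_I)
  have K: "prob_space (?K k x)" "sets (?K k x) = sets M" if "x \<in> space M" for k x
    using measurable_space[OF kernel_power_measurable[OF P] that, of k]
    by (auto simp: space_prob_algebra)
  have W_nonneg: "0 \<le> W x" if "x \<in> space (?K k y)" "y \<in> space M" for x k y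
    using W_ge[of x] that sets_eq_imp_space_eq[OF K(2)[OF that(2), of k]] by auto
  have norm_le: "weighted_norm_diff W (?K k x) (?K k x0) \<le> ereal (C * (V x + V x0) / r k)"
    if x: "x \<in> space M" for k x
  proof -
    have "weighted_norm_diff W (?K k x) (?K k x0) \<le> ereal (C * (V x + V x0)) / ereal (r k)"
      using rate[OF x x0, of k] r_pos[of k] by (subst ereal_le_divide_pos) auto
    then show ?thesis using r_pos[of k] by simp
  qed
  \<comment> \<open>The sign of \<open>C\<close> is not assumed. It follows from the rate condition
    with both points equal to \<open>x0\<close>: the norm is nonnegative and \<open>V x0\<close> is
    positive.\<close>
  have "0 \<le> C * (V x0 + V x0) / r 0"
    using order_trans[OF weighted_norm_diff_nonneg norm_le[OF x0, of 0]] W_nonneg x0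
    by (metis ereal_less_eq(5))
  then have C: "0 \<le> C"
    using r_pos[of 0] V_ge[OF x0] by (auto simp: zero_le_divide_iff zero_le_mult_iff)
  define b where "b = B + C * V x0 / r 0"
  have drift: "kernel_app (?K (n x)) W x \<le> ennreal (\<beta> * W x + b)" if x: "x \<in> space M" for x
  proof -
    have "W \<in> borel_measurable (?K (n x) x)"
      using W K(2)[OF x] by (simp cong: measurable_cong_sets)
    then have "kernel_app (?K (n x)) W x
        \<le> kernel_app (?K (n x)) W x0 + ennreal (C * (V x + V x0) / r (n x))"
      unfolding kernel_app_def using K[OF x] K[OF x0] W_nonneg x norm_le[OF x]
      by (intro nn_integral_le_weighted_norm_diff) (auto intro: prob_space.finite_measure)
    also have "\<dots> \<le> ennreal B + ennreal (C * (V x + V x0) / r (n x))"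
      by (intro add_right_mono orbit)
    also have "\<dots> = ennreal (B + C * (V x + V x0) / r (n x))"
      using B C V_ge[OF x] V_ge[OF x0] r_pos[of "n x"] by (intro ennreal_plus[symmetric]) auto
    also have "\<dots> \<le> ennreal (\<beta> * W x + b)"
    proof (rule ennreal_leI)
      have "C / \<beta> * (V x / W x) \<le> r (n x)"
        using gen_inverse_le[OF r_mono r_lim n[OF x]] .
      \<comment> \<open>Multiply by \<open>\<beta> * W x / r (n x)\<close>, which is positive since
        \<open>W x \<ge> 1\<close>.\<close>
      then have "C * V x / r (n x) \<le> \<beta> * W x"
        using W_ge[OF x] \<beta>(1) r_pos[of "n x"] by (simp add: field_simps)
      moreover have "C * V x0 / r (n x) \<le> C * V x0 / r 0"
        using C V_ge[OF x0] r_pos[of 0] monoD[OF r_mono, of 0 "n x"]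
        by (intro divide_left_mono) auto
      ultimately show "B + C * (V x + V x0) / r (n x) \<le> \<beta> * W x + b"
        by (simp add: b_def distrib_left add_divide_distrib)
    qed
    finally show ?thesis .
  qed
  \<comment> \<open>On the sublevel set the indicator is 1 and \<open>\<beta> < \<beta>'\<close>
    suffices. Off it \<open>b < (\<beta>' - \<beta>) * W x\<close>, so the larger factor absorbs
    \<open>b\<close>.\<close>
  have "\<beta> * W x + b \<le> \<beta>' * W x + b * indicator {y \<in> space M. W y \<le> b / (\<beta>' - \<beta>)} x"
    if "\<beta> < \<beta>'" "x \<in> space M" for \<beta>' x
  proof (cases "W x \<le> b / (\<beta>' - \<beta>)")
    case True
    then show ?thesis using that W_ge[OF that(2)] by simp
  next
    case False
    then show ?thesis using that by (simp add: field_simps)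
  qed
  then show ?thesis
    using drift by (intro exI[of _ b]) (meson ennreal_leI order_trans)
qed

end
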